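(* For any graph $G$, $\Pi(G)$ is a groupoid: its objects are the vertices of $G$, its arrows from $x$ to $y$ are the elements of $\Pi(G)$ represented by walks from $x$ to $y$, composition is induced by concatenation of walks, identities are the classes of the length-$0$ walks $(x)$, and the inverse of the class of $(v_0v_1\dots v_n)$ is the class of $(v_nv_{n-1}\dots v_0)$.
   Context: A graph is a finite undirected graph, loops allowed, at most one edge between two vertices. A walk of length $n$ from $x$ to $y$ is a sequence $(v_0\dots v_n)$ of vertices with $v_0=x$, $v_n=y$ and $v_i\text{---}v_{i+1}$; concatenation $(v_0\dots v_n)*(w_0\dots w_m)=(v_0\dots v_nw_1\dots w_m)$ when $v_n=w_0$. Two walks $\gamma,\gamma'$ of length $n$ are adjacent if $\gamma(i)\text{---}\gamma'(i+1)$ and $\gamma(i+1)\text{---}\gamma'(i)$ for all $0\le i<n$. Walks $\alpha,\beta$ of length $n$ from $x$ to $y$ are homotopic rel endpoints if there is a sequence $\alpha=\gamma_0,\dots,\gamma_k=\beta$ of walks of length $n$ from $x$ to $y$ with consecutive ones adjacent. $\Pi(G)$ is the set of equivalence classes of walks in $G$ (of all lengths) under the equivalence relation generated by homotopy rel endpoints and by identifying each walk $(v_0\dots v_{n-1}v_n)$ ($n\ge1$) with $(v_0\dots v_{n-1}v_nv_{n-1}v_n)$. Source and target of a class are the first and last vertex of any representative.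
   Formalization: The equivalence relation also identifies each length-0 walk (x) with (x v x) for every edge x—v; with the identification only for n≥1, the class of (x) is {(x)}, so the class of an edge (x v) would not have the class of (v x) as inverse. *)

theory Defs
  imports "Graph_Theory.Graph_Theory"
begin

text \<open>
  Graphs are \<open>pair_pseudo_graph\<close>s: finite vertex set, symmetric set of pairs as adjacency
  relation, loops allowed. A walk \<open>(v\<^sub>0 \<dots> v\<^sub>n)\<close> is the vertex list satisfying \<open>vwalk\<close>;
  \<open>vwalk_length\<close> counts edges, and \<open>\<oplus>\<close> is concatenation at a shared vertex.
\<close>

definition walks_between :: "'a pair_pre_digraph \<Rightarrow> nat \<Rightarrow> 'a \<Rightarrow> 'a \<Rightarrow> 'a vwalk set" where
  "walks_between G n x y = {p. vwalk p G \<and> vwalk_length p = n \<and> hd p = x \<and> last p = y}"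

text \<open>Only meaningful for two walks of the same length.\<close>

definition walk_adjacent :: "'a pair_pre_digraph \<Rightarrow> 'a vwalk \<Rightarrow> 'a vwalk \<Rightarrow> bool" where
  "walk_adjacent G p q \<longleftrightarrow>
    (\<forall>i < vwalk_length p. p ! i \<rightarrow>\<^bsub>G\<^esub> q ! Suc i \<and> p ! Suc i \<rightarrow>\<^bsub>G\<^esub> q ! i)"

definition homotopic_rel_endpoints ::
  "'a pair_pre_digraph \<Rightarrow> nat \<Rightarrow> 'a \<Rightarrow> 'a \<Rightarrow> 'a vwalk \<Rightarrow> 'a vwalk \<Rightarrow> bool" where
  "homotopic_rel_endpoints G n x y p q \<longleftrightarrow>
    (\<exists>(k::nat) \<gamma>. \<gamma> 0 = p \<and> \<gamma> k = q
       \<and> (\<forall>i\<le>k. \<gamma> i \<in> walks_between G n x y)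
       \<and> (\<forall>i<k. walk_adjacent G (\<gamma> i) (\<gamma> (Suc i))))"

text \<open>
  The generators of the equivalence relation defining the groupoid. The rule \<open>extend_trivial\<close>
  is the degenerate case of \<open>extend\<close> for a walk of length 0, which has no last edge to repeat:
  an arbitrary edge at its vertex is used instead. Without this rule the class of a length-0
  walk would be a singleton, since homotopy preserves length and \<open>extend\<close> only relates walks of
  positive length; then \<open>(x v)\<close> would have no inverse, its composite \<open>(x v x)\<close> with the reverse
  walk not being identified with \<open>(x)\<close>. The rule identifies no further walks of positive
  length, because any two walks \<open>(x v x)\<close> and \<open>(x w x)\<close> are adjacent.
\<close>

inductive walk_step :: "'a pair_pre_digraph \<Rightarrow> 'a vwalk \<Rightarrow> 'a vwalk \<Rightarrow> bool" for G where
  homotopy: "homotopic_rel_endpoints G n x y p q \<Longrightarrow> walk_step G p q"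
| extend: "vwalk (p @ [u, v]) G \<Longrightarrow> walk_step G (p @ [u, v]) (p @ [u, v, u, v])"
| extend_trivial: "vwalk [x, v, x] G \<Longrightarrow> walk_step G [x] [x, v, x]"

definition walk_equiv :: "'a pair_pre_digraph \<Rightarrow> ('a vwalk \<times> 'a vwalk) set" where
  "walk_equiv G = {(p, q). vwalk p G \<and> vwalk q G \<and> equivclp (walk_step G) p q}"

definition walk_class :: "'a pair_pre_digraph \<Rightarrow> 'a vwalk \<Rightarrow> 'a vwalk set" where
  "walk_class G p = walk_equiv G `` {p}"

text \<open>
  Small categories, with composition written in diagrammatic order: \<open>cmp C f g\<close> is
  \<open>f\<close> followed by \<open>g\<close>, and is constrained only when the target of \<open>f\<close> is the source of \<open>g\<close>.
\<close>

record ('o, 'm) cat_data =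
  objects :: "'o set"
  arrows :: "'m set"
  source :: "'m \<Rightarrow> 'o"
  target :: "'m \<Rightarrow> 'o"
  cmp :: "'m \<Rightarrow> 'm \<Rightarrow> 'm"
  ident :: "'o \<Rightarrow> 'm"

definition hom_arrows :: "('o, 'm) cat_data \<Rightarrow> 'o \<Rightarrow> 'o \<Rightarrow> 'm set" where
  "hom_arrows C x y = {f \<in> arrows C. source C f = x \<and> target C f = y}"

locale small_category =
  fixes C :: "('o, 'm) cat_data"
  assumes source_in: "f \<in> arrows C \<Longrightarrow> source C f \<in> objects C"
    and target_in: "f \<in> arrows C \<Longrightarrow> target C f \<in> objects C"
    and ident_in: "x \<in> objects C \<Longrightarrow> ident C x \<in> hom_arrows C x x"
    and comp_in: "f \<in> hom_arrows C x y \<Longrightarrow> g \<in> hom_arrows C y z \<Longrightarrow>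
      cmp C f g \<in> hom_arrows C x z"
    and comp_ident_left: "f \<in> hom_arrows C x y \<Longrightarrow> cmp C (ident C x) f = f"
    and comp_ident_right: "f \<in> hom_arrows C x y \<Longrightarrow> cmp C f (ident C y) = f"
    and comp_assoc: "f \<in> hom_arrows C w x \<Longrightarrow> g \<in> hom_arrows C x y \<Longrightarrow>
      h \<in> hom_arrows C y z \<Longrightarrow> cmp C (cmp C f g) h = cmp C f (cmp C g h)"

definition inverse_arrows :: "('o, 'm) cat_data \<Rightarrow> 'm \<Rightarrow> 'm \<Rightarrow> bool" where
  "inverse_arrows C f g \<longleftrightarrow> f \<in> arrows C \<and> g \<in> arrows C
    \<and> source C g = target C f \<and> target C g = source C f
    \<and> cmp C f g = ident C (source C f) \<and> cmp C g f = ident C (target C f)"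

locale small_groupoid = small_category +
  assumes ex_inverse: "f \<in> arrows C \<Longrightarrow> \<exists>g. inverse_arrows C f g"

text \<open>
  Source, target and composition are defined from all representatives at once; that they do not
  depend on the choice of representatives is part of the theorem.
\<close>

definition Pi_groupoid :: "'a pair_pre_digraph \<Rightarrow> ('a, 'a vwalk set) cat_data" where
  "Pi_groupoid G = \<lparr>
     objects = pverts G,
     arrows = {p. vwalk p G} // walk_equiv G,
     source = (\<lambda>A. the_elem (hd ` A)),
     target = (\<lambda>A. the_elem (last ` A)),
     cmp = (\<lambda>A B. \<Union>p\<in>A. \<Union>q\<in>B. walk_class G (p \<oplus> q)),
     ident = (\<lambda>x. walk_class G [x]) \<rparr>"

end

theory Submission
  imports Defs
begin

text \<open>
  The generators are equivalent to two kinds of local moves: replacing a walk by an adjacent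
  one with the same endpoints, and inserting a backtrack \<open>v u v\<close> at an arbitrary position \<open>v\<close>.
  Indeed \<open>v u v w\<close> is adjacent to \<open>v w v w\<close>, so a backtrack can be pushed along the walk until it
  reaches the end, where it is one of the given generators. Local moves visibly survive
  prolonging a walk on either side, so concatenation is well defined on classes; and \<open>p\<close>
  followed by its reverse is contracted to a point by removing backtracks at the midpoint.
\<close>

text \<open>Used in both directions to compare the given generators with the local moves: only
  single generators then have to be checked.\<close>

lemma equivclp_least:
  assumes "equivclp r x y" and "\<And>x y. r x y \<Longrightarrow> equivclp s x y"
  shows "equivclp s x y"
  using assms(1)
  by (induction rule: equivclp_induct) (auto dest: assms(2) intro: equivclp_trans equivclp_sym)

section \<open>Adjacency of vertex lists and the local moves\<close>

lemma walk_adjacent_singleton [simp]: "walk_adjacent G [x] [y]"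
  by (simp add: walk_adjacent_def)

lemma walk_adjacent_Cons_Cons [simp]:
  "walk_adjacent G (x # y # p) (x' # y' # q) \<longleftrightarrow>
    (x, y') \<in> parcs G \<and> (y, x') \<in> parcs G \<and> walk_adjacent G (y # p) (y' # q)"
  by (auto simp: walk_adjacent_def All_less_Suc2)

text \<open>Adjacency only constrains consecutive positions, so cutting at a vertex loses no
  condition as long as that vertex is kept in both halves. Equal prefix lengths put the two cut
  vertices at the same index.\<close>

lemma walk_adjacent_append:
  assumes "length p = length q"
  shows "walk_adjacent G (p @ v # a) (q @ w # b) \<longleftrightarrow>
    walk_adjacent G (p @ [v]) (q @ [w]) \<and> walk_adjacent G (v # a) (w # b)"
  using assms
proof (induction p q rule: list_induct2)
  case (Cons x p y q)
  then show ?case by (cases p; cases q) auto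
qed simp

text \<open>
  Unlike \<open>walk_adjacent_append\<close>, this does not loop as a rewrite rule, its left-hand side not
  matching \<open>p @ [v]\<close> again. The same holds for \<open>vwalk_append_Cons_Cons\<close> below.
\<close>

lemma walk_adjacent_append_Cons_Cons:
  assumes "length p = length q"
  shows "walk_adjacent G (p @ v # x # a) (q @ w # y # b) \<longleftrightarrow>
    walk_adjacent G (p @ [v]) (q @ [w]) \<and> walk_adjacent G (v # x # a) (w # y # b)"
  using assms by (rule walk_adjacent_append)

text \<open>In \<open>backtrack\<close> it is the longer list that is required to be a walk: this
  makes \<open>u\<close> a neighbour of \<open>v\<close>, and the shorter list is then a walk as
  well. With \<open>a\<close> and \<open>b\<close> empty the rule becomes
  \<open>extend_trivial\<close>.\<close>

inductive walk_move :: "'a pair_pre_digraph \<Rightarrow> 'a vwalk \<Rightarrow> 'a vwalk \<Rightarrow> bool"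
  for G :: "'a pair_pre_digraph" where
  adjacent: "vwalk p G \<Longrightarrow> vwalk q G \<Longrightarrow> length p = length q \<Longrightarrow> hd p = hd q \<Longrightarrow> last p = last q \<Longrightarrow>
    walk_adjacent G p q \<Longrightarrow> walk_move G p q"
| backtrack: "vwalk (a @ v # u # v # b) G \<Longrightarrow> walk_move G (a @ v # b) (a @ v # u # v # b)"

lemma homotopic_imp_moves:
  assumes "homotopic_rel_endpoints G n x y p q"
  shows "equivclp (walk_move G) p q"
proof -
  obtain k \<gamma> where \<gamma>: "\<gamma> 0 = p" "\<gamma> k = q" "\<forall>i\<le>k. \<gamma> i \<in> walks_between G n x y"
    "\<forall>i<k. walk_adjacent G (\<gamma> i) (\<gamma> (Suc i))"
    using assms unfolding homotopic_rel_endpoints_def by blast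
  have "walk_move G (\<gamma> i) (\<gamma> (Suc i))" if "i < k" for i
  proof (rule walk_move.adjacent)
    have w: "\<gamma> i \<in> walks_between G n x y" "\<gamma> (Suc i) \<in> walks_between G n x y"
      using \<gamma>(3) that by (simp_all add: Suc_leI)
    \<comment> \<open>\<open>vwalk_length\<close> counts edges and is 0 for \<open>[]\<close> as
      well as for a single vertex, so equal list lengths follow only once \<open>[]\<close> is
      excluded.\<close>
    then have "\<gamma> i \<noteq> []" "\<gamma> (Suc i) \<noteq> []" by (auto simp: walks_between_def vwalk_def)
    then show "length (\<gamma> i) = length (\<gamma> (Suc i))"
      using w by (cases "\<gamma> i"; cases "\<gamma> (Suc i)") (auto simp: walks_between_def)
  qed (use \<gamma> that in \<open>auto simp: walks_between_def\<close>)
  then have "equivclp (walk_move G) (\<gamma> 0) (\<gamma> j)" if "j \<le> k" for j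
    using that by (induction j) (auto intro: equivclp_into_equivclp)
  then show ?thesis using \<gamma>(1,2) by auto
qed

context pair_pseudo_graph
begin

section \<open>Walks in a symmetric graph\<close>

lemma parcs_sym: "(u, v) \<in> parcs G \<Longrightarrow> (v, u) \<in> parcs G"
  using pair_sym_arcs by (auto simp: symmetric_def dest: symD)

lemma vwalk_append_iff:
  "vwalk (a @ v # b) G \<longleftrightarrow> vwalk (a @ [v]) G \<and> vwalk (v # b) G"
proof (induction a)
  case Nil
  then show ?case by (auto simp: vwalk_def)
next
  case (Cons x a)
  then show ?case by (cases a) (auto elim: vwalkE)
qed

lemma vwalk_append_Cons_Cons:
  "vwalk (a @ v # w # b) G \<longleftrightarrow> vwalk (a @ [v]) G \<and> (v, w) \<in> parcs G \<and> vwalk (w # b) G"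
  using vwalk_append_iff[of a v "w # b"] by simp

lemma vwalk_rev: "vwalk p G \<Longrightarrow> vwalk (rev p) G"
proof (induction p)
  case (Cons x p)
  then show ?case
    by (cases p) (auto simp: vwalk_append_Cons_Cons parcs_sym in_arcsD1 in_arcsD2)
qed (simp add: vwalk_def)

lemma vwalk_join:
  assumes "vwalk p G" "vwalk q G" "last p = hd q"
  shows "vwalk (p \<oplus> q) G"
  using assms by (intro vwalk_joinI_vwalk) auto

text \<open>Each edge is needed in both directions, which symmetry of the graph provides. This takes
  care of the unchanged portions when a walk is altered locally.\<close>

lemma walk_adjacent_refl: "vwalk p G \<Longrightarrow> walk_adjacent G p p"
  by (induction p rule: vwalk_induct) (auto simp: parcs_sym)

lemma move_endpoints:
  assumes "walk_move G p q"
  shows "vwalk p G" "vwalk q G" "hd p = hd q" "last p = last q"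
  using assms
  by (auto elim!: walk_move.cases simp: vwalk_append_Cons_Cons hd_append
      intro: vwalk_append_iff[THEN iffD2])

section \<open>The given generators and the local moves generate the same equivalence\<close>

lemma adjacent_imp_step:
  assumes "vwalk p G" "vwalk q G" "length p = length q" "hd p = hd q" "last p = last q"
    "walk_adjacent G p q"
  shows "walk_step G p q"
proof (rule walk_step.homotopy)
  show "homotopic_rel_endpoints G (vwalk_length p) (hd p) (last p) p q"
    unfolding homotopic_rel_endpoints_def
    \<comment> \<open>A chain with a single step, from index 0 to index 1.\<close>
    by (rule exI[of _ 1], rule exI[of _ "\<lambda>i. if i = 0 then p else q"])
      (use assms in \<open>auto simp: walks_between_def\<close>)
qed

text \<open>On the altered segment both walks visit \<open>v\<close> at every other position, so all
  crossing edges join \<open>v\<close> to \<open>u\<close> or \<open>w\<close>. Outside it each walk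
  is adjacent to itself.\<close>

lemma shift_backtrack:
  assumes "vwalk (a @ v # u # v # w # b) G"
  shows "walk_step G (a @ v # u # v # w # b) (a @ v # w # v # w # b)"
proof (rule adjacent_imp_step)
  have "vwalk (v # u # v # w # b) G" "vwalk (a @ [v]) G" "vwalk (w # b) G"
    using assms by (simp_all add: vwalk_append_Cons_Cons)
  then show "vwalk (a @ v # w # v # w # b) G"
    "walk_adjacent G (a @ v # u # v # w # b) (a @ v # w # v # w # b)"
    by (auto simp: vwalk_append_Cons_Cons walk_adjacent_append_Cons_Cons walk_adjacent_refl
        parcs_sym)
qed (use assms in \<open>auto simp: hd_append\<close>)

text \<open>Induction on the part after the insertion point. The prefix, the point and the tip of
  the detour are generalised because each step moves the detour one vertex to the right.\<close>

lemma backtrack_equiv: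
  assumes "vwalk (a @ v # u # v # b) G"
  shows "equivclp (walk_step G) (a @ v # b) (a @ v # u # v # b)"
  using assms
proof (induction b arbitrary: a v u)
  case Nil
  show ?case
  proof (cases a rule: rev_cases)
    case Nil
    \<comment> \<open>A lone vertex has no last edge for \<open>extend\<close> to repeat, hence
      \<open>extend_trivial\<close>.\<close>
    then show ?thesis using Nil.prems walk_step.extend_trivial[of v u G] by auto
  next
    case (snoc a' w)
    have vw: "vwalk (a' @ w # v # u # [v]) G" using Nil snoc by simp
    then have arcs: "vwalk (a' @ [w]) G" "vwalk (w # v # u # [v]) G"
      using vwalk_append_iff by blast+
    \<comment> \<open>\<open>extend\<close> can only repeat the last edge, which gives the detour
      \<open>v w v\<close>; an adjacency then replaces its tip \<open>w\<close> by
      \<open>u\<close>.\<close>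
    have "walk_step G (a' @ [w, v]) (a' @ [w, v, w, v])"
      using arcs by (intro walk_step.extend) (auto simp: vwalk_append_Cons_Cons)
    moreover have "walk_step G (a' @ [w, v, w, v]) (a' @ [w, v, u, v])"
    proof (rule adjacent_imp_step)
      show "vwalk (a' @ [w, v, w, v]) G" "walk_adjacent G (a' @ [w, v, w, v]) (a' @ [w, v, u, v])"
        using arcs
        by (auto simp: vwalk_append_Cons_Cons walk_adjacent_append_Cons_Cons walk_adjacent_refl
            parcs_sym)
    qed (use vw in \<open>auto simp: hd_append\<close>)
    ultimately show ?thesis using snoc by (auto intro: equivclp_trans)
  qed
next
  case (Cons w b)
  have step: "walk_step G (a @ v # u # v # w # b) (a @ v # w # v # w # b)"
    by (rule shift_backtrack) (rule Cons.prems)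
  have "vwalk (a @ [v]) G" "vwalk (v # u # v # w # b) G"
    using Cons.prems vwalk_append_iff by blast+
  \<comment> \<open>The induction hypothesis is applied one vertex further right, at
    \<open>w\<close> with detour to \<open>v\<close>. It produces \<open>v w v w\<close>, which
    \<open>step\<close> links to \<open>v u v w\<close>.\<close>
  then have "vwalk ((a @ [v]) @ w # v # w # b) G"
    by (auto simp: vwalk_append_Cons_Cons parcs_sym)
  from Cons.IH[OF this] step show ?case
    by (auto intro: equivclp_trans)
qed

lemma equivclp_walk_step: "equivclp (walk_step G) = equivclp (walk_move G)"
proof (intro ext iffI)
  fix p q
  assume "equivclp (walk_step G) p q"
  then show "equivclp (walk_move G) p q"
  proof (rule equivclp_least)
    fix p q
    assume "walk_step G p q"
    then show "equivclp (walk_move G) p q"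
    proof cases
      case homotopy
      then show ?thesis by (rule homotopic_imp_moves)
    next
      case (extend r u v)
      \<comment> \<open>Repeating the last edge is a backtrack from the last vertex \<open>v\<close>
        to \<open>u\<close>, with nothing after it.\<close>
      then have "vwalk ((r @ [u]) @ v # u # v # []) G"
        by (auto simp: vwalk_append_Cons_Cons parcs_sym in_arcsD1 in_arcsD2)
      from walk_move.backtrack[OF this] show ?thesis using extend by auto
    next
      case (extend_trivial x v)
      then show ?thesis using walk_move.backtrack[of "[]" x v "[]"] by auto
    qed
  qed
next
  fix p q
  assume "equivclp (walk_move G) p q"
  then show "equivclp (walk_step G) p q"
  proof (rule equivclp_least)
    fix p q
    assume "walk_move G p q"
    then show "equivclp (walk_step G) p q"
      by cases (auto intro: backtrack_equiv adjacent_imp_step)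
  qed
qed

section \<open>The equivalence relation on walks\<close>

lemma walk_equiv_iff:
  "(p, q) \<in> walk_equiv G \<longleftrightarrow> vwalk p G \<and> vwalk q G \<and> equivclp (walk_move G) p q"
  by (simp add: walk_equiv_def equivclp_walk_step)

lemma equiv_walk_equiv: "equiv {p. vwalk p G} (walk_equiv G)"
  by (intro equivI refl_onI symI transI)
    (auto simp: walk_equiv_def intro: equivclp_sym equivclp_trans)

text \<open>There are two step cases because \<open>backtrack\<close> only lengthens a walk.
  Membership in \<open>walk_equiv\<close> is carried along so that the endpoints of intermediate
  walks are known.\<close>

lemma walk_equiv_induct [consumes 1, case_names refl step step_back]:
  assumes "(p, q) \<in> walk_equiv G" "P p"
    and "\<And>r s. (p, r) \<in> walk_equiv G \<Longrightarrow> walk_move G r s \<Longrightarrow> P r \<Longrightarrow> P s"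
    and "\<And>r s. (p, r) \<in> walk_equiv G \<Longrightarrow> walk_move G s r \<Longrightarrow> P r \<Longrightarrow> P s"
  shows "P q"
proof -
  have p: "vwalk p G" and "equivclp (walk_move G) p q"
    using assms(1) by (simp_all add: walk_equiv_iff)
  from this(2) have "(p, q) \<in> walk_equiv G \<and> P q"
  proof (induction rule: equivclp_induct)
    case base
    then show ?case using p assms(2) by (simp add: walk_equiv_iff)
  next
    case (step r s)
    then have "(p, s) \<in> walk_equiv G"
      by (auto simp: walk_equiv_iff dest: move_endpoints intro: equivclp_into_equivclp)
    with step assms(3,4) show ?case by blast
  qed
  then show ?thesis ..
qed

lemma move_into_walk_equiv: "walk_move G p q \<Longrightarrow> (p, q) \<in> walk_equiv G"
  by (auto simp: walk_equiv_iff move_endpoints)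

lemma walk_equiv_sym: "(p, q) \<in> walk_equiv G \<Longrightarrow> (q, p) \<in> walk_equiv G"
  by (auto simp: walk_equiv_def intro: equivclp_sym)

lemma walk_equiv_trans:
  "(p, q) \<in> walk_equiv G \<Longrightarrow> (q, r) \<in> walk_equiv G \<Longrightarrow> (p, r) \<in> walk_equiv G"
  by (auto simp: walk_equiv_def intro: equivclp_trans)

lemma walk_equiv_endpoints:
  assumes "(p, q) \<in> walk_equiv G"
  shows "hd p = hd q" "last p = last q"
proof -
  from assms have "hd p = hd q \<and> last p = last q"
    by (induction rule: walk_equiv_induct) (auto dest: move_endpoints)
  then show "hd p = hd q" "last p = last q" by auto
qed

section \<open>Concatenation respects equivalence\<close>

lemma move_append_right:
  assumes "walk_move G p q" "vwalk (last p # r) G"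
  shows "walk_move G (p @ r) (q @ r)"
  using assms(1)
proof cases
  case adjacent
  then have "p \<noteq> []" "q \<noteq> []" by (auto simp: vwalk_def)
  \<comment> \<open>The common last vertex becomes the cut vertex; beyond it both walks continue
    along the same \<open>r\<close>, where adjacency is reflexive.\<close>
  then obtain p' q' where p: "p = p' @ [last p]" and q: "q = q' @ [last p]"
    using adjacent(5) by (metis append_butlast_last_id)
  have len: "length p' = length q'" using adjacent(3) by (subst (asm) p, subst (asm) q) simp
  have "vwalk (p' @ last p # r) G" "vwalk (q' @ last p # r) G"
    using adjacent(1,2) assms(2) p q vwalk_append_iff by metis+
  moreover have "walk_adjacent G (p' @ last p # r) (q' @ last p # r)"
    using adjacent(6) assms(2) p q walk_adjacent_append[OF len] walk_adjacent_refl by metis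
  moreover have "hd (p' @ last p # r) = hd (q' @ last p # r)"
    using adjacent(4) p q by (metis hd_append list.sel(1))
  ultimately have "walk_move G (p' @ last p # r) (q' @ last p # r)"
    using len by (intro walk_move.adjacent) auto
  then show ?thesis using p q by (metis append.assoc append_Cons append_Nil)
next
  case (backtrack a v u b)
  \<comment> \<open>The same backtrack is inserted; only its remainder grows from \<open>b\<close>
    to \<open>b @ r\<close>.\<close>
  have "vwalk ((a @ v # u # v # b) \<oplus> (last p # r)) G"
    by (rule vwalk_join) (use backtrack assms(2) in auto)
  then have "vwalk (a @ v # u # v # (b @ r)) G" by (simp add: vwalk_join_def)
  from walk_move.backtrack[OF this] show ?thesis using backtrack by simp
qed

lemma move_append_left:
  assumes "walk_move G p q" "vwalk (r @ [hd p]) G"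
  shows "walk_move G (r @ p) (r @ q)"
  using assms(1)
proof cases
  case adjacent
  then have "p \<noteq> []" "q \<noteq> []" by (auto simp: vwalk_def)
  then obtain v p' q' where pq: "p = v # p'" "q = v # q'"
    using adjacent(4) by (metis list.collapse)
  have "vwalk (r @ v # p') G" "vwalk (r @ v # q') G"
    using adjacent(1,2) assms(2) pq vwalk_append_iff by (metis list.sel(1))+
  moreover have "walk_adjacent G (r @ v # p') (r @ v # q')"
    using adjacent(6) assms(2) pq walk_adjacent_append[OF refl] walk_adjacent_refl
    by (metis list.sel(1))
  ultimately show ?thesis
    using adjacent pq by (intro walk_move.adjacent) (auto simp: hd_append)
next
  case (backtrack a v u b)
  have "hd (a @ v # u # v # b) = hd p" using backtrack by (simp add: hd_append)
  then have "vwalk ((r @ [hd p]) \<oplus> (a @ v # u # v # b)) G"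
    using assms(2) backtrack by (intro vwalk_join) auto
  then have "vwalk ((r @ a) @ v # u # v # b) G"
    using \<open>hd (a @ v # u # v # b) = hd p\<close> by (simp add: vwalk_join_def2)
  from walk_move.backtrack[OF this] show ?thesis using backtrack by simp
qed

lemma walk_equiv_append_right:
  assumes "(p, q) \<in> walk_equiv G" "vwalk (last p # r) G"
  shows "(p @ r, q @ r) \<in> walk_equiv G"
  using assms(1)
proof (induction rule: walk_equiv_induct)
  case refl
  have "vwalk (p \<oplus> (last p # r)) G"
    using assms by (intro vwalk_join) (auto simp: walk_equiv_def)
  then show ?case by (simp add: walk_equiv_def vwalk_join_def)
next
  case (step q s)
  then have "walk_move G (q @ r) (s @ r)"
    using assms(2) by (intro move_append_right) (auto dest: walk_equiv_endpoints)
  with step.IH show ?case by (blast intro: walk_equiv_trans move_into_walk_equiv)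
next
  case (step_back q s)
  then have "last s = last p" by (metis walk_equiv_endpoints(2) move_endpoints(4))
  with step_back.hyps assms(2) have "walk_move G (s @ r) (q @ r)"
    by (intro move_append_right) auto
  with step_back.IH show ?case
    by (blast intro: walk_equiv_trans walk_equiv_sym move_into_walk_equiv)
qed

lemma walk_equiv_append_left:
  assumes "(p, q) \<in> walk_equiv G" "vwalk (r @ [hd p]) G"
  shows "(r @ p, r @ q) \<in> walk_equiv G"
  using assms(1)
proof (induction rule: walk_equiv_induct)
  case refl
  have "p \<noteq> []" "vwalk p G" using assms(1) by (auto simp: walk_equiv_def vwalk_def)
  then have "vwalk (r @ p) G"
    using vwalk_join[OF assms(2), of p] by (simp add: vwalk_join_def2)
  then show ?case by (simp add: walk_equiv_def)
next
  case (step q s)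
  then have "walk_move G (r @ q) (r @ s)"
    using assms(2) by (intro move_append_left) (auto dest: walk_equiv_endpoints)
  with step.IH show ?case by (blast intro: walk_equiv_trans move_into_walk_equiv)
next
  case (step_back q s)
  then have "hd s = hd p" by (metis walk_equiv_endpoints(1) move_endpoints(3))
  with step_back.hyps assms(2) have "walk_move G (r @ s) (r @ q)"
    by (intro move_append_left) auto
  with step_back.IH show ?case
    by (blast intro: walk_equiv_trans walk_equiv_sym move_into_walk_equiv)
qed

text \<open>One factor is replaced at a time. The shared vertex is dropped first from the second
  factor (\<open>tl q\<close>), then from the first (\<open>butlast p'\<close>), so that each time
  the join is an append with one side fixed.\<close>

lemma walk_equiv_join:
  assumes "(p, p') \<in> walk_equiv G" "(q, q') \<in> walk_equiv G" "last p = hd q"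
  shows "(p \<oplus> q, p' \<oplus> q') \<in> walk_equiv G"
proof -
  have walks: "vwalk p' G" "vwalk q G" and ne: "p' \<noteq> []" "q \<noteq> []" "q' \<noteq> []"
    using assms(1,2) by (auto simp: walk_equiv_def vwalk_def)
  have ends: "last p' = hd q" "hd q' = hd q"
    using assms walk_equiv_endpoints by fastforce+
  have "vwalk (last p # tl q) G" using walks(2) ne(2) assms(3) by simp
  then have "(p \<oplus> q, p' \<oplus> q) \<in> walk_equiv G"
    using walk_equiv_append_right[OF assms(1)] by (simp add: vwalk_join_def)
  moreover have "vwalk (butlast p' @ [hd q]) G"
    using walks(1) ne(1) ends(1) by (metis append_butlast_last_id)
  then have "(p' \<oplus> q, p' \<oplus> q') \<in> walk_equiv G"
    using walk_equiv_append_left[OF assms(2)] ne ends by (simp add: vwalk_join_def2)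
  ultimately show ?thesis by (rule walk_equiv_trans)
qed

text \<open>Peeling \<open>p\<close> from its end exposes the midpoint of the composite:
  \<open>x y x\<close> there is a backtrack, and removing it leaves the composite for the shorter
  walk.\<close>

lemma walk_join_rev:
  assumes "vwalk p G"
  shows "(p \<oplus> rev p, [hd p]) \<in> walk_equiv G"
  using assms
proof (induction p rule: rev_induct)
  case Nil
  then show ?case by (simp add: vwalk_def)
next
  case (snoc y p)
  show ?case
  proof (cases p rule: rev_cases)
    case Nil
    then show ?thesis using snoc.prems by (simp add: vwalk_join_def walk_equiv_def)
  next
    case (snoc q x)
    then have "vwalk (q @ [x, y]) G" using snoc.prems by simp
    then have *: "vwalk (q @ [x]) G" "(x, y) \<in> parcs G" "vwalk (x # rev q) G"
      using vwalk_rev[of "q @ [x]"] by (auto simp: vwalk_append_Cons_Cons)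
    then have "vwalk (q @ x # y # x # rev q) G"
      by (auto simp: vwalk_append_Cons_Cons parcs_sym)
    then have "((p @ [y]) \<oplus> rev (p @ [y]), p \<oplus> rev p) \<in> walk_equiv G"
      using walk_equiv_sym[OF move_into_walk_equiv[OF walk_move.backtrack]] snoc
      by (simp add: vwalk_join_def)
    moreover have "(p \<oplus> rev p, [hd (p @ [y])]) \<in> walk_equiv G"
      using snoc.IH * snoc by (cases q) auto
    ultimately show ?thesis by (rule walk_equiv_trans)
  qed
qed

section \<open>The groupoid structure on classes\<close>

lemma walk_class_self: "vwalk p G \<Longrightarrow> p \<in> walk_class G p"
  by (simp add: walk_class_def walk_equiv_def)

lemma walk_class_eq: "(p, q) \<in> walk_equiv G \<Longrightarrow> walk_class G p = walk_class G q"
  unfolding walk_class_def by (rule equiv_class_eq[OF equiv_walk_equiv])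

lemma mem_walk_class: "q \<in> walk_class G p \<longleftrightarrow> (p, q) \<in> walk_equiv G"
  by (simp add: walk_class_def)

lemma arrows_Pi: "arrows (Pi_groupoid G) = {walk_class G p |p. vwalk p G}"
  by (auto simp: Pi_groupoid_def quotient_def walk_class_def)

text \<open>End vertices are invariant under equivalence and the class is nonempty, so
  \<open>the_elem\<close> is taken of a singleton.\<close>

lemma source_Pi: "vwalk p G \<Longrightarrow> source (Pi_groupoid G) (walk_class G p) = hd p"
  and target_Pi: "vwalk p G \<Longrightarrow> target (Pi_groupoid G) (walk_class G p) = last p"
proof -
  assume p: "vwalk p G"
  have "hd q = hd p \<and> last q = last p" if "q \<in> walk_class G p" for q
    using that walk_equiv_endpoints unfolding mem_walk_class by metis
  moreover have "walk_class G p \<noteq> {}" using walk_class_self[OF p] by blast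
  ultimately show "source (Pi_groupoid G) (walk_class G p) = hd p"
    and "target (Pi_groupoid G) (walk_class G p) = last p"
    by (simp_all add: Pi_groupoid_def the_elem_image_unique)
qed

lemma hom_Pi:
  "hom_arrows (Pi_groupoid G) x y = {walk_class G p |p. vwalk p G \<and> hd p = x \<and> last p = y}"
  by (auto simp: hom_arrows_def arrows_Pi source_Pi target_Pi)

lemma cmp_Pi:
  assumes "vwalk p G" "vwalk q G" "last p = hd q"
  shows "cmp (Pi_groupoid G) (walk_class G p) (walk_class G q) = walk_class G (p \<oplus> q)"
proof -
  let ?A = "walk_class G p" and ?B = "walk_class G q"
  have "walk_class G (p' \<oplus> q') = walk_class G (p \<oplus> q)" if "p' \<in> ?A" "q' \<in> ?B" for p' q'
    using that assms(3) unfolding mem_walk_class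
    by (intro walk_class_eq[symmetric] walk_equiv_join)
  then have "cmp (Pi_groupoid G) ?A ?B = (\<Union>p'\<in>?A. \<Union>q'\<in>?B. walk_class G (p \<oplus> q))"
    by (simp add: Pi_groupoid_def)
  \<comment> \<open>A constant union equals its value only over nonempty index sets;
    \<open>p\<close> and \<open>q\<close> themselves witness this.\<close>
  also have "\<dots> = walk_class G (p \<oplus> q)"
    using walk_class_self[OF assms(1)] walk_class_self[OF assms(2)] by blast
  finally show ?thesis .
qed

lemma ident_Pi: "ident (Pi_groupoid G) x = walk_class G [x]"
  and objects_Pi: "objects (Pi_groupoid G) = pverts G"
  by (simp_all add: Pi_groupoid_def)

lemma vwalk_ends_in_verts: "vwalk p G \<Longrightarrow> hd p \<in> pverts G" "vwalk p G \<Longrightarrow> last p \<in> pverts G"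
  by (auto simp: vwalk_def)

lemma inverse_Pi:
  assumes "vwalk p G"
  shows "inverse_arrows (Pi_groupoid G) (walk_class G p) (walk_class G (rev p))"
proof -
  have r: "vwalk (rev p) G" and ne: "p \<noteq> []"
    using assms vwalk_rev by (auto simp: vwalk_def)
  \<comment> \<open>The second equation is the first one for \<open>rev p\<close>, whose reverse is
    \<open>p\<close> and whose first vertex is \<open>last p\<close>.\<close>
  have "walk_class G (p \<oplus> rev p) = walk_class G [hd p]"
    "walk_class G (rev p \<oplus> p) = walk_class G [last p]"
    using walk_class_eq[OF walk_join_rev[OF assms]] walk_class_eq[OF walk_join_rev[OF r]] ne
    by (simp_all add: hd_rev)
  then show ?thesis
    using assms r ne
    by (auto simp: inverse_arrows_def arrows_Pi source_Pi target_Pi cmp_Pi ident_Pi hd_rev last_rev)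
qed

text \<open>Once \<open>cmp_Pi\<close> allows computing with representatives, the laws hold already
  for lists: joining walks is strictly associative, and single vertices are strict units.\<close>

lemma small_category_Pi: "small_category (Pi_groupoid G)"
proof
  fix f g h w x y z
  assume "f \<in> hom_arrows (Pi_groupoid G) w x" "g \<in> hom_arrows (Pi_groupoid G) x y"
    "h \<in> hom_arrows (Pi_groupoid G) y z"
  then obtain p q r where "f = walk_class G p" "vwalk p G" "last p = x"
    "g = walk_class G q" "vwalk q G" "hd q = x" "last q = y"
    "h = walk_class G r" "vwalk r G" "hd r = y"
    unfolding hom_Pi by blast
  moreover from this have "p \<noteq> []" "q \<noteq> []" "r \<noteq> []" by (auto simp: vwalk_def)
  ultimately show "cmp (Pi_groupoid G) (cmp (Pi_groupoid G) f g) h =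
      cmp (Pi_groupoid G) f (cmp (Pi_groupoid G) g h)"
    by (simp add: cmp_Pi vwalk_join vwalk_join_last vwalk_join_hd vwalk_join_assoc)
next
  fix f g x y z
  assume "f \<in> hom_arrows (Pi_groupoid G) x y" "g \<in> hom_arrows (Pi_groupoid G) y z"
  then obtain p q where pq: "f = walk_class G p" "vwalk p G" "hd p = x" "last p = y"
    "g = walk_class G q" "vwalk q G" "hd q = y" "last q = z"
    unfolding hom_Pi by blast
  then have "p \<noteq> []" "q \<noteq> []" by (auto simp: vwalk_def)
  with pq have "vwalk (p \<oplus> q) G" "hd (p \<oplus> q) = x" "last (p \<oplus> q) = z"
    by (simp_all add: vwalk_join vwalk_join_hd vwalk_join_last)
  with pq show "cmp (Pi_groupoid G) f g \<in> hom_arrows (Pi_groupoid G) x z"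
    unfolding hom_Pi by (auto simp: cmp_Pi)
next
  fix f x y
  assume "f \<in> hom_arrows (Pi_groupoid G) x y"
  then obtain p where p: "f = walk_class G p" "vwalk p G" "hd p = x" "last p = y"
    unfolding hom_Pi by blast
  then have "p \<noteq> []" by (auto simp: vwalk_def)
  with p have "[x] \<oplus> p = p" "p \<oplus> [y] = p" by (auto simp: vwalk_join_def)
  with p show "cmp (Pi_groupoid G) (ident (Pi_groupoid G) x) f = f"
    "cmp (Pi_groupoid G) f (ident (Pi_groupoid G) y) = f"
    using vwalk_ends_in_verts[OF p(2)] by (simp_all add: ident_Pi cmp_Pi)
next
  fix x
  assume "x \<in> objects (Pi_groupoid G)"
  then have "vwalk [x] G" by (simp add: objects_Pi)
  then show "ident (Pi_groupoid G) x \<in> hom_arrows (Pi_groupoid G) x x"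
    unfolding ident_Pi hom_Pi by fastforce
qed (auto simp: arrows_Pi source_Pi target_Pi objects_Pi vwalk_ends_in_verts)

lemma small_groupoid_Pi: "small_groupoid (Pi_groupoid G)"
  by (intro small_groupoid.intro small_category_Pi small_groupoid_axioms.intro)
    (auto simp: arrows_Pi intro: inverse_Pi)

end

theorem theorem6p9:
  fixes G :: "'a pair_pre_digraph"
  assumes "pair_pseudo_graph G"
  shows "small_groupoid (Pi_groupoid G)
    \<and> objects (Pi_groupoid G) = pverts G
    \<and> equiv {p. vwalk p G} (walk_equiv G)
    \<and> arrows (Pi_groupoid G) = {p. vwalk p G} // walk_equiv G
    \<and> (\<forall>A \<in> arrows (Pi_groupoid G). \<forall>p \<in> A.
         source (Pi_groupoid G) A = hd p \<and> target (Pi_groupoid G) A = last p)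
    \<and> (\<forall>x \<in> pverts G. \<forall>y \<in> pverts G.
         hom_arrows (Pi_groupoid G) x y = {walk_class G p |p. vwalk p G \<and> hd p = x \<and> last p = y})
    \<and> (\<forall>p q. vwalk p G \<and> vwalk q G \<and> last p = hd q \<longrightarrow>
         cmp (Pi_groupoid G) (walk_class G p) (walk_class G q) = walk_class G (p \<oplus> q))
    \<and> (\<forall>x \<in> pverts G. ident (Pi_groupoid G) x = walk_class G [x])
    \<and> (\<forall>p. vwalk p G \<longrightarrow>
         inverse_arrows (Pi_groupoid G) (walk_class G p) (walk_class G (rev p)))"
proof -
  interpret pair_pseudo_graph G by (rule assms)
  \<comment> \<open>Here \<open>p\<close> is an arbitrary member of the class, so this is the
    independence of representatives, obtained from the invariance of endpoints.\<close>
  have ends: "source (Pi_groupoid G) A = hd p \<and> target (Pi_groupoid G) A = last p"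
    if "A \<in> arrows (Pi_groupoid G)" "p \<in> A" for A p
    using that
    by (auto simp: arrows_Pi source_Pi target_Pi mem_walk_class dest: walk_equiv_endpoints)
  have "arrows (Pi_groupoid G) = {p. vwalk p G} // walk_equiv G"
    by (simp add: Pi_groupoid_def)
  with ends show ?thesis
    by (simp add: small_groupoid_Pi objects_Pi equiv_walk_equiv hom_Pi cmp_Pi ident_Pi inverse_Pi)
qed

end
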